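(* Suppose that for all words $v=v_0\dots v_n$ and $w=w_0\dots w_n$ in $\mathcal W$ with $v\sim w$, $v_0\neq w_0$ and $v^-\not\sim w^-$ it holds that $m(v)=m(\tilde w)$ for all $\tilde w\sim v$. Then for every $w\in\mathcal W$, either $m(w)=m(\tilde w)$ for all $\tilde w\sim w$, or $w^-\sim\tilde w^-$ for all $\tilde w\sim w$.
   Context: Setting. Let $S_1,\dots,S_N: D\to D$ ($D\subseteq\mathbb R^d$) be similarities, $|S_i(x)-S_i(y)|=c_i|x-y|$ with $0<c_i<1$, forming an iterated function system (IFS) with attractor $K$, the unique non-empty compact set with $K=\bigcup_{i=1}^N S_i(K)$. The open set condition is assumed: there is a non-empty bounded open set $\mathcal O\subset\mathbb R^d$ with $\bigcup_{i=1}^N S_i(\mathcal O)\subset\mathcal O$, the union being disjoint. Words. $\mathcal A=\{1,\dots,N\}$ is the alphabet and $\mathcal W=\bigcup_{n\ge1}\mathcal A^n\cup\{\emptyset\}$ the set of finite words, where $\emptyset$ is the empty word. $|w|$ is the length of $w$. For a non-empty word $w$ the parent $w^-$ is $w$ with its last letter removed. For $w=w_0\dots w_n$ put $S_w=S_{w_0}\circ\dots\circ S_{w_n}$, with $S_\emptyset$ the identity. Relation. For $v,w\in\mathcal W$, $v\sim w$ if and only if $v=w$, or $|v|=|w|$, $S_v(K)\cap S_w(K)\neq\emptyset$ (the intersection is a non-empty set) and $v^-\neq w^-$. It is a standing assumption that $\sim$ is an equivalence relation on $\mathcal W$. Mass distribution. $m(a)\in(0,1)$ for $a\in\mathcal A$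 with $\sum_{a\in\mathcal A}m(a)=1$, $m(\emptyset)=1$, and $m$ of a word is the product of the masses of its letters. In the conclusion of the claim the "either/or" is inclusive; the empty word, equivalent only to itself, fulfills the first alternative. *)

theory Defs
  imports "HOL-Analysis.Analysis"
begin

definition similarity_ifs ::
  "'a::metric_space set \<Rightarrow> nat \<Rightarrow> (nat \<Rightarrow> real) \<Rightarrow> (nat \<Rightarrow> 'a \<Rightarrow> 'a) \<Rightarrow> bool" where
  "similarity_ifs D N c S \<longleftrightarrow>
     (\<forall>i\<in>{1..N}. 0 < c i \<and> c i < 1 \<and> S i ` D \<subseteq> D \<and>
        (\<forall>x\<in>D. \<forall>y\<in>D. dist (S i x) (S i y) = c i * dist x y))"

definition is_attractor ::
  "'a::metric_space set \<Rightarrow> nat \<Rightarrow> (nat \<Rightarrow> 'a \<Rightarrow> 'a) \<Rightarrow> 'a set \<Rightarrow> bool" where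
  "is_attractor D N S K \<longleftrightarrow>
     compact K \<and> K \<noteq> {} \<and> K \<subseteq> D \<and> K = (\<Union>i\<in>{1..N}. S i ` K)"

text \<open>Uniqueness is not a clause of the predicate since it is automatic:\<close>

lemma is_attractor_subset:
  fixes K L :: "'a::heine_borel set"
  assumes S: "similarity_ifs D N c S"
    and K: "is_attractor D N S K" and L: "is_attractor D N S L"
  shows "K \<subseteq> L"
proof -
  have "compact K" "K \<noteq> {}" using K by (auto simp: is_attractor_def)
  then obtain x where x: "x \<in> K" and max: "\<And>y. y \<in> K \<Longrightarrow> infdist y L \<le> infdist x L"
    using continuous_attains_sup[of K "\<lambda>y. infdist y L"]
      continuous_on_infdist[OF continuous_on_id, of K L] by blast
  obtain i y where i: "i \<in> {1..N}" and y: "y \<in> K" and xy: "x = S i y"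
    using K x unfolding is_attractor_def by blast
  have ci: "0 < c i" "c i < 1" using S i by (auto simp: similarity_ifs_def)
  have Lp: "compact L" "L \<noteq> {}" using L by (auto simp: is_attractor_def)
  then obtain l where l: "l \<in> L" and dl: "infdist y L = dist y l"
    using infdist_attains_inf[of L y] compact_imp_closed by metis
  have "S i l \<in> L" using L l i unfolding is_attractor_def by blast
  then have "infdist x L \<le> dist (S i y) (S i l)"
    unfolding xy by (rule infdist_le)
  also have "\<dots> = c i * infdist y L"
    using S K L i y l dl unfolding similarity_ifs_def is_attractor_def by (metis subsetD)
  also have "\<dots> \<le> c i * infdist x L"
    using max[OF y] ci by simp
  finally have "infdist x L \<le> c i * infdist x L" .
  then have "(1 - c i) * infdist x L \<le> 0" by (simp add: algebra_simps)
  then have "infdist x L \<le> 0" using ci by (simp add: mult_le_0_iff)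
  then have "infdist z L = 0" if "z \<in> K" for z
    using max[OF that] infdist_nonneg[of z L] by linarith
  then show ?thesis
    using Lp in_closed_iff_infdist_zero[of L] compact_imp_closed by blast
qed

lemma is_attractor_unique:
  fixes K L :: "'a::heine_borel set"
  assumes "similarity_ifs D N c S" "is_attractor D N S K" "is_attractor D N S L"
  shows "K = L"
  using assms is_attractor_subset by blast

text \<open>
  The open set \<open>U\<close> is not required to lie in \<open>D\<close>: the maps are total functions of which
  \<open>similarity_ifs\<close> constrains only the values on \<open>D\<close>, so this covers both the case
  \<open>U \<subseteq> D\<close> and the case where the similarities are extended beyond \<open>D\<close>.
\<close>

definition open_set_condition ::
  "nat \<Rightarrow> (nat \<Rightarrow> 'a::metric_space \<Rightarrow> 'a) \<Rightarrow> bool" where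
  "open_set_condition N S \<longleftrightarrow>
     (\<exists>U. open U \<and> bounded U \<and> U \<noteq> {} \<and>
        (\<Union>i\<in>{1..N}. S i ` U) \<subseteq> U \<and> disjoint_family_on (\<lambda>i. S i ` U) {1..N})"

definition words :: "nat \<Rightarrow> nat list set" where
  "words N = lists {1..N}"

definition word_map :: "(nat \<Rightarrow> 'a \<Rightarrow> 'a) \<Rightarrow> nat list \<Rightarrow> 'a \<Rightarrow> 'a" where
  "word_map S w = foldr (\<circ>) (map S w) id"

text \<open>
  The parent of a word is its \<^const>\<open>butlast\<close>. The convention \<open>butlast [] = []\<close> is harmless
  below: the empty word is the only word of length 0.
\<close>

definition word_rel :: "nat \<Rightarrow> (nat \<Rightarrow> 'a \<Rightarrow> 'a) \<Rightarrow> 'a set \<Rightarrow> (nat list \<times> nat list) set" where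
  "word_rel N S K = {(v, w). v \<in> words N \<and> w \<in> words N \<and>
     (v = w \<or>
      length v = length w \<and> word_map S v ` K \<inter> word_map S w ` K \<noteq> {} \<and>
      butlast v \<noteq> butlast w)}"

definition mass_distribution :: "nat \<Rightarrow> (nat \<Rightarrow> real) \<Rightarrow> bool" where
  "mass_distribution N m \<longleftrightarrow>
     (\<forall>a\<in>{1..N}. 0 < m a \<and> m a < 1) \<and> (\<Sum>a\<in>{1..N}. m a) = 1"

definition word_mass :: "(nat \<Rightarrow> real) \<Rightarrow> nat list \<Rightarrow> real" where
  "word_mass m w = prod_list (map m w)"

end

theory Submission
  imports Defs
begin

text \<open>
  A similarity is injective, so prepending one letter to two words maps the intersection of
  their cells bijectively onto the intersection of the new cells. Hence \<open>\<sim>\<close> is invariant under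
  adding and cancelling a common first letter (\<open>word_rel_Cons_iff\<close>). This is the only place
  where geometry enters; the rest is combinatorics of an equivalence relation on words with
  this invariance (\<open>word_mass_eq_if_parents_unrelated\<close>).

  Suppose a class contains words \<open>a\<close> and \<open>b\<close> whose parents are not equivalent. If all words of
  the class begin with the same letter, cancel it: the class becomes a class of shorter words
  with the same property, and all masses are divided by the same factor. So assume that some
  word \<open>y\<close> of the class begins differently from \<open>a\<close>. The parent of \<open>y\<close> cannot be equivalent to
  the parents of both \<open>a\<close> and \<open>b\<close>, because these are not equivalent to each other. If \<open>b\<close>
  begins differently from \<open>a\<close>, then \<open>a\<close> and \<open>b\<close> have different first letters and inequivalent
  parents; otherwise \<open>y\<close> and one of \<open>a\<close>, \<open>b\<close> do. The hypothesis, applied to these two words,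
  makes the mass constant on the whole class.
\<close>

lemma word_map_Cons: "word_map S (i # v) = S i \<circ> word_map S v"
  by (simp add: word_map_def)

lemma Cons_in_words_iff: "i # v \<in> words N \<longleftrightarrow> i \<in> {1..N} \<and> v \<in> words N"
  by (simp add: words_def)

lemma butlast_in_words: "v \<in> words N \<Longrightarrow> butlast v \<in> words N"
  by (auto simp: words_def in_lists_conv_set dest: in_set_butlastD)

lemma word_rel_length: "(v, w) \<in> word_rel N S K \<Longrightarrow> length v = length w"
  by (auto simp: word_rel_def)

lemma similarity_ifs_inj_on:
  assumes "similarity_ifs D N c S" "i \<in> {1..N}"
  shows "inj_on (S i) D"
proof (rule inj_onI)
  fix x y assume "x \<in> D" "y \<in> D" "S i x = S i y"
  then have "c i * dist x y = 0" "0 < c i"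
    using assms unfolding similarity_ifs_def by (metis dist_self, blast)
  then show "x = y" by simp
qed

lemma word_map_image_subset:
  assumes S: "similarity_ifs D N c S" and "K \<subseteq> D" "v \<in> words N"
  shows "word_map S v ` K \<subseteq> D"
  using \<open>v \<in> words N\<close>
proof (induction v)
  case Nil
  then show ?case using \<open>K \<subseteq> D\<close> by (simp add: word_map_def)
next
  case (Cons i v)
  then have "word_map S v ` K \<subseteq> D" "S i ` D \<subseteq> D"
    using S by (auto simp: Cons_in_words_iff similarity_ifs_def)
  then show ?case by (auto simp: word_map_Cons)
qed

text \<open>
  The condition on the parents survives as well: for non-empty words the parent of \<open>i # v\<close> is
  \<open>i # butlast v\<close>, and the empty word is equivalent only to itself.
\<close>

lemma word_rel_Cons_iff:
  assumes S: "similarity_ifs D N c S" and K: "K \<subseteq> D"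
    and i: "i \<in> {1..N}" and v: "v \<in> words N" and w: "w \<in> words N"
  shows "(i # v, i # w) \<in> word_rel N S K \<longleftrightarrow> (v, w) \<in> word_rel N S K"
proof -
  have "word_map S (i # v) ` K \<inter> word_map S (i # w) ` K
      = S i ` (word_map S v ` K \<inter> word_map S w ` K)"
    using inj_on_image_Int[OF similarity_ifs_inj_on[OF S i]
        word_map_image_subset[OF S K v] word_map_image_subset[OF S K w]]
    by (simp add: word_map_Cons image_comp)
  then show ?thesis
    using i v w by (auto simp: word_rel_def Cons_in_words_iff)
qed

text \<open>
  The induction removes first letters only as long as the whole class shares them. Cancelling
  the common prefix of \<open>a\<close> and \<open>b\<close> alone would not do: the hypothesis would then speak about the
  words of the class that have this prefix and say nothing about the others.
\<close>

lemma word_mass_eq_if_parents_unrelated: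
  assumes equiv: "equiv (words N) R"
    and len: "\<And>v w. (v, w) \<in> R \<Longrightarrow> length v = length w"
    and cancel: "\<And>i v w. \<lbrakk>i \<in> {1..N}; v \<in> words N; w \<in> words N\<rbrakk>
                   \<Longrightarrow> (i # v, i # w) \<in> R \<longleftrightarrow> (v, w) \<in> R"
    and first: "\<And>v w w'. \<lbrakk>v \<noteq> []; w \<noteq> []; (v, w) \<in> R; hd v \<noteq> hd w;
                   (butlast v, butlast w) \<notin> R; (w', v) \<in> R\<rbrakk>
                 \<Longrightarrow> word_mass m v = word_mass m w'"
    and "(a, b) \<in> R" "(butlast a, butlast b) \<notin> R" "(x, a) \<in> R"
  shows "word_mass m x = word_mass m a"
  using \<open>(a, b) \<in> R\<close> \<open>(butlast a, butlast b) \<notin> R\<close> \<open>(x, a) \<in> R\<close>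
proof (induction a arbitrary: b x)
  have in_words: "v \<in> words N" "w \<in> words N" if "(v, w) \<in> R" for v w
    using equiv that by (auto dest: equiv_type)
  have refl: "(v, v) \<in> R" if "v \<in> words N" for v
    using equiv that by (auto dest: equivE refl_onD)
  have sym: "(w, v) \<in> R" if "(v, w) \<in> R" for v w
    using equiv that by (auto elim: equivE dest: symD)
  have trans: "(u, w) \<in> R" if "(u, v) \<in> R" "(v, w) \<in> R" for u v w
    using equiv that by (auto elim!: equivE dest: transD)
  {
    case Nil
    then have "b = []" using len by fastforce
    then show ?case using Nil in_words refl by auto
  next
    case (Cons i a)
    have i: "i \<in> {1..N}" and a: "a \<in> words N"
      using in_words[OF Cons.prems(1)] by (auto simp: Cons_in_words_iff)
    have nonempty: "y \<noteq> []" if "(y, i # a) \<in> R" for y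
      using len[OF that] by auto
    have b: "b \<noteq> []" "(b, i # a) \<in> R"
      using nonempty sym Cons.prems(1) by blast+
    show ?case
    proof (cases "\<forall>y. (y, i # a) \<in> R \<longrightarrow> hd y = i")
      case True
      then obtain b' x' where b': "b = i # b'" and x': "x = i # x'"
        using b nonempty Cons.prems(3) by (metis list.collapse)
      have words: "b' \<in> words N" "x' \<in> words N"
        using in_words(2)[OF Cons.prems(1)] in_words(1)[OF Cons.prems(3)]
        by (simp_all add: b' x' Cons_in_words_iff)
      have ab: "(a, b') \<in> R" and xa: "(x', a) \<in> R"
        using Cons.prems(1,3) cancel i a words by (auto simp: b' x')
      \<comment> \<open>For one-letter words cancellation would not act on the parents, but these all have
         the empty parent.\<close>
      have "a \<noteq> []"
      proof
        assume "a = []"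
        then have "b' = []" using len[OF ab] by simp
        then have "butlast b = butlast (i # a)" using \<open>a = []\<close> by (simp add: b')
        then show False
          using Cons.prems(2) refl butlast_in_words[of "i # a"] in_words[OF Cons.prems(1)] by auto
      qed
      moreover have "b' \<noteq> []" using \<open>a \<noteq> []\<close> len[OF ab] by auto
      ultimately have "(butlast a, butlast b') \<notin> R"
        using Cons.prems(2) cancel i a words butlast_in_words by (auto simp: b')
      then have "word_mass m x' = word_mass m a"
        using Cons.IH ab xa by blast
      then show ?thesis by (simp add: x' word_mass_def)
    next
      case False
      then obtain y where y: "(y, i # a) \<in> R" "hd y \<noteq> i" by blast
      consider "hd b \<noteq> i" | "(butlast (i # a), butlast y) \<notin> R"
        | "hd b = i" "(butlast (i # a), butlast y) \<in> R" by blast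
      then show ?thesis
      proof cases
        case 1
        then show ?thesis
          using first[of "i # a" b x] Cons.prems b by auto
      next
        case 2
        then show ?thesis
          using first[of "i # a" y x] Cons.prems y sym nonempty by auto
      next
        case 3
        \<comment> \<open>The class of \<open>b\<close> is that of \<open>a\<close>, so it does no harm that the hypothesis
           compares masses with \<open>b\<close>.\<close>
        then have unrelated: "(butlast b, butlast y) \<notin> R"
          using Cons.prems(2) trans sym by blast
        have by_rel: "(b, y) \<in> R" using trans b y sym by blast
        have const: "word_mass m b = word_mass m z" if "(z, b) \<in> R" for z
          using first[of b y z] that b(1) nonempty y 3(1) by_rel unrelated by auto
        have "(x, b) \<in> R" using trans Cons.prems(1,3) by blast
        then show ?thesis using const Cons.prems(1) by metis
      qed
    qed
  }
qed

theorem proposition3: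
  fixes D K :: "(real ^ 'd) set"
    and N :: nat
    and c m :: "nat \<Rightarrow> real"
    and S :: "nat \<Rightarrow> real ^ 'd \<Rightarrow> real ^ 'd"
  assumes "similarity_ifs D N c S"
    and "is_attractor D N S K"
    and "open_set_condition N S"
    and "equiv (words N) (word_rel N S K)"
    and "mass_distribution N m"
    and "\<And>v w w'. \<lbrakk>v \<noteq> []; w \<noteq> []; (v, w) \<in> word_rel N S K; hd v \<noteq> hd w;
            (butlast v, butlast w) \<notin> word_rel N S K; (w', v) \<in> word_rel N S K\<rbrakk>
          \<Longrightarrow> word_mass m v = word_mass m w'"
  shows "\<forall>w\<in>words N.
           (\<forall>w'. (w', w) \<in> word_rel N S K \<longrightarrow> word_mass m w = word_mass m w') \<or>
           (\<forall>w'. (w', w) \<in> word_rel N S K \<longrightarrow> (butlast w, butlast w') \<in> word_rel N S K)"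
proof (intro ballI)
  fix w
  let ?R = "word_rel N S K"
  have "K \<subseteq> D" using assms(2) by (simp add: is_attractor_def)
  have const: "word_mass m x = word_mass m a"
    if "(a, b) \<in> ?R" "(butlast a, butlast b) \<notin> ?R" "(x, a) \<in> ?R" for a b x
  proof (rule word_mass_eq_if_parents_unrelated[OF assms(4) _ _ _ that])
    show "length u = length v" if "(u, v) \<in> ?R" for u v
      using that by (rule word_rel_length)
    show "(i # u, i # v) \<in> ?R \<longleftrightarrow> (u, v) \<in> ?R"
      if "i \<in> {1..N}" "u \<in> words N" "v \<in> words N" for i u v
      using word_rel_Cons_iff[OF assms(1) \<open>K \<subseteq> D\<close>] that by blast
    show "word_mass m u = word_mass m u'"
      if "u \<noteq> []" "v \<noteq> []" "(u, v) \<in> ?R" "hd u \<noteq> hd v"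
        "(butlast u, butlast v) \<notin> ?R" "(u', u) \<in> ?R" for u v u'
      using that by (rule assms(6))
  qed
  have sym: "(v, u) \<in> ?R" if "(u, v) \<in> ?R" for u v
    using assms(4) that by (auto elim: equivE dest: symD)
  show "(\<forall>w'. (w', w) \<in> ?R \<longrightarrow> word_mass m w = word_mass m w') \<or>
        (\<forall>w'. (w', w) \<in> ?R \<longrightarrow> (butlast w, butlast w') \<in> ?R)"
  proof (intro disjCI allI impI)
    fix x
    assume "\<not> (\<forall>w'. (w', w) \<in> ?R \<longrightarrow> (butlast w, butlast w') \<in> ?R)" and x: "(x, w) \<in> ?R"
    then obtain b where "(b, w) \<in> ?R" "(butlast w, butlast b) \<notin> ?R" by blast
    then have "word_mass m x = word_mass m w"
      using const sym x by blast
    then show "word_mass m w = word_mass m x" by simp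
  qed
qed

end
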